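(* Let $d\ge 2$, let $a,p,m,k,N$ be nonzero integers (with $N>0$) such that $\gcd(m,p)=1$, $\gcd(ap,N)=1$ and $(am^d-kN)/p$ is a nonzero integer, and let $s$ be a positive integer. Then the polynomials $f_1,f_2$ returned by Algorithm B on these inputs satisfy $$\|f_i\|_{2,s}\le s^{-\frac{\deg f_i}{2}}\left(2^{\frac{d(d-1)}{4}}s^{\frac{d^2}{2}}(\tilde{a}/a)\,\|\vec{c}\|_{2,s^{-1}}\right)^{\frac{1}{d-i+1}},\qquad i=1,2,$$ where $\vec{c}=[c_0,\dots,c_d]=\left[ap^{d-1},ap^{d-2}m,\dots,am^{d-1},\frac{am^d-kN}{p}\right]$ and $\tilde{a}=a/\gcd(a,c_d)$.
   Context: For a real polynomial $h=\sum_{i=0}^{e}h_ix^i$ of degree $e$, $\|h\|_{2,s}=\left(\sum_{i=0}^{e}|h_is^{\,i-e/2}|^2\right)^{1/2}$. For $\vec{x}=(x_0,\dots,x_d)\in\mathbb{R}^{d+1}$, $\|\vec{x}\|_{2,s^{-1}}=s^{d/2}\left(\sum_{i=0}^{d}x_i^2s^{-2i}\right)^{1/2}$. Algorithm A. Input: nonzero integers $m,p,\tilde{k},N$ with $\gcd(m,p)=1$, and integers $a_j,\dots,a_n$ with $1\le j\le n$ such that $p^{n-j+1}$ divides $\tilde{k}N-\sum_{i=j}^{n}a_im^ip^{n-i}$. Steps: (1) If $j=n$ set $r_j=\tilde{k}N$; otherwise $r_j=\left(\tilde{k}N-\sum_{i=j+1}^{n}a_im^ip^{n-i}\right)/p^{n-j}$.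 (2) For $i=j-1,\dots,0$ compute $r_i=(r_{i+1}-a_{i+1}m^{i+1})/p$ and $a_i=(r_i+t_ip)/m^i$, where $t_i\in[-m^i/2,m^i/2)\cap\mathbb{Z}$, $t_i\equiv -r_i/p\pmod{m^i}$. (3) Return $\sum_{i=0}^n a_ix^i$, which satisfies $\tilde{f}(m/p)p^n=\tilde{k}N$. Algorithm B (inputs $d,a,p,m,k,N,s$ as in the claim). (1) Compute $g=\gcd(a,(am^d-kN)/p)$ and apply Algorithm A with $n=j=d$, $a_n=a/g$ and $\tilde{k}=k/g$ to obtain $\tilde{f}=\sum_{i=0}^d a_ix^i$ with $\tilde{f}(m/p)p^d=\tilde{k}N$. (2) Let $B$ be the $d\times(d+1)$ integer matrix whose first row is $(a_0,\dots,a_d)$ and whose remaining rows are the coefficient vectors (constant term first, length $d+1$) of $x^{d-2}(px-m),x^{d-3}(px-m),\dots,x(px-m),(px-m)$, in this order. Let $S=\mathrm{diag}(1,s,\dots,s^d)$. Compute an LLL-reduced basis $(\vec{b}_1,\dots,\vec{b}_d)$ (in the sense of Lenstra–Lenstra–Lovász) of the lattice with basis matrix $BS$. (3) Writing $\vec{b}_i=(b_{i,0},\dots,b_{i,d})S$ for $i=1,2$, return $f_1=\sum_{j=0}^d b_{1,j}x^j$ and $f_2=\sum_{j=0}^d b_{2,j}x^j$.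
   Formalization: In Algorithm A the interval for t_i is taken as [-|m|^i/2, |m|^i/2) instead of [-m^i/2, m^i/2), since the latter is empty for negative m and odd i; the two agree whenever m^i > 0. *)

theory Defs
  imports
    Complex_Main
    "HOL-Computational_Algebra.Polynomial"
    "HOL-Number_Theory.Cong"
    "Jordan_Normal_Form.Matrix"
begin

subsection \<open>Skewed norms\<close>

definition poly_skew_norm :: "real \<Rightarrow> real poly \<Rightarrow> real" where
  "poly_skew_norm s h =
     sqrt (\<Sum>i\<le>degree h. \<bar>coeff h i * s powr (real i - real (degree h) / 2)\<bar>\<^sup>2)"

(* The norm indexed by (2, 1/s); a vector (x_0, ..., x_d) has dimension d + 1. *)
definition vec_inv_skew_norm :: "real \<Rightarrow> real vec \<Rightarrow> real" where
  "vec_inv_skew_norm s x =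
     (let d = dim_vec x - 1
      in s powr (real d / 2) * sqrt (\<Sum>i\<le>d. (x $ i)\<^sup>2 * s powr (- 2 * real i)))"

subsection \<open>Lattices and LLL-reduced bases\<close>

definition row_lattice :: "real mat \<Rightarrow> real vec set" where
  "row_lattice A =
     {transpose_mat A *\<^sub>v map_vec of_int x | x :: int vec. x \<in> carrier_vec (dim_row A)}"

definition is_lattice_basis :: "real mat \<Rightarrow> real vec set \<Rightarrow> bool" where
  "is_lattice_basis A L \<longleftrightarrow>
     (\<forall>x \<in> carrier_vec (dim_row A).
        transpose_mat A *\<^sub>v x = 0\<^sub>v (dim_col A) \<longrightarrow> x = 0\<^sub>v (dim_row A)) \<and>
     row_lattice A = L"

(* Gram-Schmidt orthogonalisation (without normalisation) of the rows of A, indexed from 0. *)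
fun gram_schmidt_row :: "real mat \<Rightarrow> nat \<Rightarrow> real vec" where
  "gram_schmidt_row A i =
     row A i - vec (dim_col A) (\<lambda>l. \<Sum>j<i.
       (row A i \<bullet> gram_schmidt_row A j) / (gram_schmidt_row A j \<bullet> gram_schmidt_row A j)
         * gram_schmidt_row A j $ l)"

declare gram_schmidt_row.simps [simp del]

definition gram_schmidt_mu :: "real mat \<Rightarrow> nat \<Rightarrow> nat \<Rightarrow> real" where
  "gram_schmidt_mu A i j =
     (row A i \<bullet> gram_schmidt_row A j) / (gram_schmidt_row A j \<bullet> gram_schmidt_row A j)"

(* Lenstra, Lenstra, Lovasz (1982), conditions (1.4) and (1.5), with constant 3/4. *)
definition LLL_reduced :: "real mat \<Rightarrow> bool" where
  "LLL_reduced A \<longleftrightarrow>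
     (\<forall>i < dim_row A. \<forall>j < i. \<bar>gram_schmidt_mu A i j\<bar> \<le> 1 / 2) \<and>
     (\<forall>i. Suc i < dim_row A \<longrightarrow>
        (let v = gram_schmidt_row A (Suc i)
                 + gram_schmidt_mu A (Suc i) i \<cdot>\<^sub>v gram_schmidt_row A i
         in v \<bullet> v \<ge> 3 / 4 * (gram_schmidt_row A i \<bullet> gram_schmidt_row A i)))"

subsection \<open>Algorithm A\<close>

(* t_i, for r = r_i. The residue -r/p is taken modulo m^i, hence the congruence for t * p.
   The interval has end points -|m|^i / 2 and |m|^i / 2, so that negative m is covered. *)
definition algA_shift :: "int \<Rightarrow> int \<Rightarrow> int \<Rightarrow> nat \<Rightarrow> int" where
  "algA_shift m p r i =
     (THE t. - (\<bar>m\<bar> ^ i) \<le> 2 * t \<and> 2 * t < \<bar>m\<bar> ^ i \<and> [t * p = - r] (mod m ^ i))"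

(* The pair (r_i, a_i) for i = j - l, after l passes of the loop. All divisions are exact under
   the input conditions: gcd(m,p) = 1 and p^(n-j+1) divides kt N - sum_{i=j..n} a_i m^i p^(n-i). *)
primrec algA_loop ::
  "int \<Rightarrow> int \<Rightarrow> int \<Rightarrow> int \<Rightarrow> nat \<Rightarrow> nat \<Rightarrow> (nat \<Rightarrow> int) \<Rightarrow> nat \<Rightarrow> int \<times> int" where
  "algA_loop m p kt N j n a 0 =
     (if j = n then kt * N
      else (kt * N - (\<Sum>i = j + 1..n. a i * m ^ i * p ^ (n - i))) div p ^ (n - j),
      a j)"
| "algA_loop m p kt N j n a (Suc l) =
     (let (r', a') = algA_loop m p kt N j n a l;
          i = j - Suc l;
          r = (r' - a' * m ^ (i + 1)) div p
      in (r, (r + algA_shift m p r i * p) div m ^ i))"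

(* The input coefficients are a_j, ..., a_n; the values a i for i outside {j..n} are not used. *)
definition algA ::
  "int \<Rightarrow> int \<Rightarrow> int \<Rightarrow> int \<Rightarrow> nat \<Rightarrow> nat \<Rightarrow> (nat \<Rightarrow> int) \<Rightarrow> int poly" where
  "algA m p kt N j n a =
     (\<Sum>i\<le>n. monom (if j \<le> i then a i else snd (algA_loop m p kt N j n a (j - i))) i)"

subsection \<open>Algorithm B\<close>

definition algB_gcd :: "nat \<Rightarrow> int \<Rightarrow> int \<Rightarrow> int \<Rightarrow> int \<Rightarrow> int \<Rightarrow> int" where
  "algB_gcd d a p m k N = gcd a ((a * m ^ d - k * N) div p)"

definition algB_start :: "nat \<Rightarrow> int \<Rightarrow> int \<Rightarrow> int \<Rightarrow> int \<Rightarrow> int \<Rightarrow> int poly" where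
  "algB_start d a p m k N =
     (let g = algB_gcd d a p m k N in algA m p (k div g) N d d (\<lambda>_. a div g))"

definition algB_matrix :: "nat \<Rightarrow> int \<Rightarrow> int \<Rightarrow> int \<Rightarrow> int \<Rightarrow> int \<Rightarrow> int mat" where
  "algB_matrix d a p m k N =
     mat d (d + 1) (\<lambda>(i, j).
       if i = 0 then coeff (algB_start d a p m k N) j
       else coeff (monom 1 (d - 1 - i) * [:- m, p:]) j)"

definition skew_matrix :: "nat \<Rightarrow> int \<Rightarrow> int mat" where
  "skew_matrix d s = mat_diag (d + 1) (\<lambda>i. s ^ i)"

(* f 1, f 2 are possible outputs of the algorithm. LLL-reduced bases are not unique, so the output
   is a relation; the basis vectors are rows 0, ..., d - 1 of R. *)
definition algB_output ::
  "nat \<Rightarrow> int \<Rightarrow> int \<Rightarrow> int \<Rightarrow> int \<Rightarrow> int \<Rightarrow> int \<Rightarrow> (nat \<Rightarrow> real poly) \<Rightarrow> bool" where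
  "algB_output d a p m k N s f \<longleftrightarrow>
     (\<exists>R \<in> carrier_mat d (d + 1).
        is_lattice_basis R
          (row_lattice (map_mat of_int (algB_matrix d a p m k N * skew_matrix d s))) \<and>
        LLL_reduced R \<and>
        (\<forall>i \<in> {1, 2}. \<exists>b \<in> carrier_vec (d + 1).
           row R (i - 1) = transpose_mat (map_mat of_int (skew_matrix d s)) *\<^sub>v b \<and>
           f i = (\<Sum>j\<le>d. monom (b $ j) j)))"

definition c_vec :: "nat \<Rightarrow> int \<Rightarrow> int \<Rightarrow> int \<Rightarrow> int \<Rightarrow> int \<Rightarrow> int vec" where
  "c_vec d a p m k N =
     vec (d + 1) (\<lambda>j. if j < d then a * p ^ (d - 1 - j) * m ^ j else (a * m ^ d - k * N) div p)"

end

theory Submission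
  imports Defs "Jordan_Normal_Form.Determinant"
begin

text \<open>
  Algorithm A makes the first row of the basis matrix \<open>B\<close> orthogonal to \<open>c\<close>, and so are the rows
  \<open>x ^ e (p x - m)\<close>. Hence the maximal minors of \<open>B S\<close> are proportional to the entries
  \<open>c\<^sub>j s\<^bsup>-j\<^esup>\<close>, and the minor belonging to \<open>c\<^sub>0\<close> is triangular; this gives the determinant of the
  lattice as \<open>s\<^bsup>d(d+1)/2\<^esup> / gcd a c\<^sub>d\<close> times the norm of \<open>(c\<^sub>j s\<^bsup>-j\<^esup>)\<^sub>j\<close>.
  The rest is the estimate \<open>|b\<^sub>i|\<^sup>2 \<le> 2\<^bsup>j\<^esup> |b\<^sup>*\<^sub>j|\<^sup>2\<close> (rows counted from 0, \<open>i \<le> j\<close>) for LLL-reduced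
  bases, multiplied over \<open>j \<ge> i\<close>; for the second vector one also uses \<open>|b\<^sub>0| \<ge> 1\<close>, which holds
  because the lattice is integral.
\<close>

subsection \<open>Correctness of Algorithm A\<close>

text \<open>The description in \<open>algA_shift\<close> denotes something because \<open>p\<close>
  is invertible modulo \<open>m ^ i\<close>, so the congruence fixes one residue class, and a
  half-open interval of length \<open>\<bar>m\<bar> ^ i\<close> meets every class exactly
  once.\<close>

lemma algA_shift_props:
  assumes "m \<noteq> 0" and "coprime m p"
  shows "- (\<bar>m\<bar> ^ i) \<le> 2 * algA_shift m p r i"
    and "2 * algA_shift m p r i < \<bar>m\<bar> ^ i"
    and "[algA_shift m p r i * p = - r] (mod m ^ i)"
proof -
  let ?M = "\<bar>m\<bar> ^ i"
  let ?P = "\<lambda>t. - ?M \<le> 2 * t \<and> 2 * t < ?M \<and> [t * p = - r] (mod m ^ i)"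
  have M: "?M > 0" using assms(1) by simp
  have modM: "[x = y] (mod m ^ i) \<longleftrightarrow> [x = y] (mod ?M)" for x y
    by (simp add: cong_iff_dvd_diff flip: power_abs)
  have cop: "coprime p ?M" using assms(2)
    by (simp add: coprime_commute)
  obtain q where q: "[p * q = 1] (mod ?M)"
    using cop cong_solve_coprime_int by blast
  \<comment> \<open>Adding \<open>h\<close>, reducing modulo \<open>?M\<close> and subtracting
    \<open>h\<close> again moves the representative from \<open>[0, ?M)\<close> into the centred
    interval; the two bounds on \<open>h\<close> cover both parities of \<open>?M\<close>.\<close>
  define h where "h = ?M div 2"
  define e where "e = (- r * q + h) mod ?M"
  define t where "t = e - h"
  have "0 \<le> e" "e < ?M" using M unfolding e_def by simp_all
  moreover have "2 * h \<le> ?M" "?M \<le> 2 * h + 1" unfolding h_def by presburger+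
  ultimately have b: "- ?M \<le> 2 * t \<and> 2 * t < ?M" unfolding t_def by presburger
  have "[t = - r * q] (mod ?M)"
    unfolding t_def e_def by (simp add: cong_def mod_diff_left_eq)
  then have "[t * p = - r * q * p] (mod ?M)" by (rule cong_mult[OF _ cong_refl])
  also have "- r * q * p = - r * (p * q)" by simp
  also have "[\<dots> = - r * 1] (mod ?M)" using q by (rule cong_mult[OF cong_refl])
  finally have ex: "?P t" using b by (simp add: modM)
  have uniq: "u = t" if "?P u" for u
  proof -
    have "[u * p = t * p] (mod ?M)"
      using that ex by (metis modM cong_sym cong_trans)
    then have "[u = t] (mod ?M)"
      using cop by (simp add: cong_mult_rcancel)
    then have "?M dvd u - t" by (simp add: cong_iff_dvd_diff)
    moreover have "\<bar>u - t\<bar> < ?M"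
      using that ex by (auto simp: abs_less_iff)
    ultimately show ?thesis
      using dvd_imp_le_int[of "u - t" ?M] by force
  qed
  have "?P (algA_shift m p r i)"
    unfolding algA_shift_def by (rule theI[of ?P, OF ex uniq])
  then show "- (\<bar>m\<bar> ^ i) \<le> 2 * algA_shift m p r i"
    and "2 * algA_shift m p r i < \<bar>m\<bar> ^ i"
    and "[algA_shift m p r i * p = - r] (mod m ^ i)" by auto
qed

text \<open>Both uses of \<open>div\<close> in the loop are exact: the first by the divisibility
  assumption, the second because the shift is chosen to make the numerator a multiple of
  \<open>m ^ (j - Suc l)\<close>.\<close>

lemma algA_loop_Suc:
  assumes "m \<noteq> 0" "coprime m p"
    and "algA_loop m p kt N j n a l = (r', a')"
    and "algA_loop m p kt N j n a (Suc l) = (r, b)"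
    and "Suc l \<le> j"
    and "p dvd r' - a' * m ^ (j - l)"
  shows "p * r = r' - a' * m ^ (j - l)"
    and "b * m ^ (j - Suc l) = r + algA_shift m p r (j - Suc l) * p"
proof -
  let ?i = "j - Suc l"
  have j: "Suc ?i = j - l" using assms(5) by simp
  have r: "r = (r' - a' * m ^ (j - l)) div p"
    and b: "b = (r + algA_shift m p r ?i * p) div m ^ ?i"
    using assms(3,4) by (auto simp: Let_def j simp flip: power_Suc)
  show "p * r = r' - a' * m ^ (j - l)" using assms(6) unfolding r by simp
  have "m ^ ?i dvd r + algA_shift m p r ?i * p"
    using algA_shift_props(3)[OF assms(1,2), of r ?i]
    by (simp add: cong_iff_dvd_diff add.commute)
  then show "b * m ^ ?i = r + algA_shift m p r ?i * p" unfolding b by simp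
qed

text \<open>After \<open>l\<close> passes, \<open>p ^ l * r l\<close> is what remains of
  \<open>kt * N\<close> once the terms of the \<open>l\<close> highest coefficients are subtracted.
  The divisibility part keeps the next division exact; it persists because
  \<open>b (Suc l) * m ^ (n - Suc l)\<close> and \<open>r (Suc l)\<close> differ by a multiple of
  \<open>p\<close>.\<close>

lemma algA_loop_invariant:
  fixes m p kt N :: int and n :: nat and a :: "nat \<Rightarrow> int"
  defines "r \<equiv> \<lambda>l. fst (algA_loop m p kt N n n a l)"
    and "b \<equiv> \<lambda>l. snd (algA_loop m p kt N n n a l)"
  assumes "m \<noteq> 0" "coprime m p" "p dvd kt * N - a n * m ^ n" "l \<le> n"
  shows "kt * N = p ^ l * r l + (\<Sum>i<l. b i * m ^ (n - i) * p ^ i)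
    \<and> p dvd r l - b l * m ^ (n - l)"
  using \<open>l \<le> n\<close>
proof (induction l)
  case 0
  then show ?case using assms(5) by (simp add: r_def b_def)
next
  case (Suc l)
  have rb: "algA_loop m p kt N n n a l = (r l, b l)" for l
    by (simp add: r_def b_def)
  note step = algA_loop_Suc[OF assms(3,4) rb[of l] rb[of "Suc l"] Suc.prems]
  have IH: "kt * N = p ^ l * r l + (\<Sum>i<l. b i * m ^ (n - i) * p ^ i)"
    "p dvd r l - b l * m ^ (n - l)" using Suc by simp_all
  have "r l = p * r (Suc l) + b l * m ^ (n - l)" using step(1)[OF IH(2)] by simp
  then have "kt * N = p ^ Suc l * r (Suc l) + (\<Sum>i<Suc l. b i * m ^ (n - i) * p ^ i)"
    using IH(1) by (simp add: algebra_simps)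
  moreover have "p dvd r (Suc l) - b (Suc l) * m ^ (n - Suc l)"
    unfolding step(2)[OF IH(2)] by simp
  ultimately show ?case by blast
qed

lemma coeff_algA:
  "coeff (algA m p kt N n n a) i =
    (if i < n then snd (algA_loop m p kt N n n a (n - i)) else if i = n then a n else 0)"
proof -
  have "coeff (algA m p kt N n n a) i =
      (\<Sum>l\<le>n. if l = i then (if n \<le> l then a l else snd (algA_loop m p kt N n n a (n - l))) else 0)"
    by (simp add: algA_def coeff_sum)
  then show ?thesis by (simp only: sum.delta finite_atMost) auto
qed

lemma algA_correct:
  assumes "m \<noteq> 0" "coprime m p" "p dvd kt * N - a n * m ^ n" "n > 0"
  shows "(\<Sum>i\<le>n. coeff (algA m p kt N n n a) i * m ^ i * p ^ (n - i)) = kt * N"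
proof -
  define r where "r = (\<lambda>l. fst (algA_loop m p kt N n n a l))"
  define b where "b = (\<lambda>l. snd (algA_loop m p kt N n n a l))"
  have rb: "algA_loop m p kt N n n a l = (r l, b l)" for l
    by (simp add: r_def b_def)
  have inv: "l \<le> n \<Longrightarrow> kt * N = p ^ l * r l + (\<Sum>i<l. b i * m ^ (n - i) * p ^ i)
    \<and> p dvd r l - b l * m ^ (n - l)" for l
    unfolding r_def b_def by (rule algA_loop_invariant[where a = a and n = n, OF assms(1-3)])
  obtain l where l: "n = Suc l" using assms(4) gr0_conv_Suc by auto
  have "b n = r n + algA_shift m p (r n) 0 * p"
    using algA_loop_Suc(2)[OF assms(1,2) rb rb, of l] inv[of l] l by simp
  \<comment> \<open>Modulo \<open>m ^ 0\<close> the only admissible shift is 0.\<close>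
  moreover have "algA_shift m p (r n) 0 = 0"
    using algA_shift_props(1,2)[OF assms(1,2), where r = "r n" and i = 0] by simp
  ultimately have bn: "b n = r n" by simp
  have "kt * N = (\<Sum>i\<le>n. b i * m ^ (n - i) * p ^ i)"
    using inv[of n] bn by (simp add: lessThan_Suc_atMost[symmetric])
  \<comment> \<open>The loop runs downwards, so \<open>b l\<close> is the coefficient of degree
    \<open>n - l\<close>; the sum is reversed.\<close>
  also have "\<dots> = (\<Sum>i\<le>n. b (n - i) * m ^ i * p ^ (n - i))"
    by (rule sum.reindex_bij_witness[of _ "\<lambda>i. n - i" "\<lambda>i. n - i"]) auto
  also have "\<dots> = (\<Sum>i\<le>n. coeff (algA m p kt N n n a) i * m ^ i * p ^ (n - i))"
    by (intro sum.cong refl) (auto simp: coeff_algA b_def)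
  finally show ?thesis by simp
qed

subsection \<open>Gram--Schmidt vectors and Gram determinants\<close>

lemma real_scalar_prod_self_nonneg: "0 \<le> v \<bullet> (v :: real vec)"
  by (auto simp: scalar_prod_def intro: sum_nonneg)

lemma real_scalar_prod_self_eq_0:
  "v \<bullet> (v :: real vec) = 0 \<longleftrightarrow> v = 0\<^sub>v (dim_vec v)"
proof -
  have "v \<bullet> v = 0 \<longleftrightarrow> (\<forall>i<dim_vec v. v $ i = 0)"
    by (auto simp: scalar_prod_def sum_nonneg_eq_0_iff)
  then show ?thesis by (metis eq_vecI index_zero_vec)
qed

lemma dim_gram_schmidt_row [simp]: "dim_vec (gram_schmidt_row A i) = dim_col A"
  by (simp only: gram_schmidt_row.simps[of A i] index_minus_vec dim_vec)

lemma gram_schmidt_row_carrier [simp]: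
  "gram_schmidt_row A i \<in> carrier_vec (dim_col A)"
  by (rule carrier_vecI) simp

lemma row_eq_gram_schmidt:
  assumes "l < dim_col A"
  shows "row A i $ l =
    gram_schmidt_row A i $ l + (\<Sum>j<i. gram_schmidt_mu A i j * gram_schmidt_row A j $ l)"
  using assms by (simp add: gram_schmidt_row.simps[of A i] gram_schmidt_mu_def)

lemma scalar_prod_row_gram_schmidt:
  assumes "x \<in> carrier_vec (dim_col A)"
  shows "row A i \<bullet> x =
    gram_schmidt_row A i \<bullet> x + (\<Sum>j<i. gram_schmidt_mu A i j * (gram_schmidt_row A j \<bullet> x))"
proof -
  let ?g = "gram_schmidt_row A" and ?n = "dim_col A"
  have "row A i \<bullet> x =
    (\<Sum>l<?n. ?g i $ l * x $ l + (\<Sum>j<i. gram_schmidt_mu A i j * (?g j $ l * x $ l)))"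
    using assms unfolding scalar_prod_def atLeast0LessThan
    by (intro sum.cong) (auto simp del: index_row simp: row_eq_gram_schmidt distrib_right sum_distrib_right mult.assoc)
  also have "\<dots> = ?g i \<bullet> x + (\<Sum>j<i. gram_schmidt_mu A i j * (?g j \<bullet> x))"
    using assms unfolding scalar_prod_def atLeast0LessThan sum.distrib
    by (subst sum.swap) (simp add: sum_distrib_left)
  finally show ?thesis .
qed

text \<open>No linear independence is assumed. If the squared norm vanishes, the quotient defining
  the coefficient is 0 by convention, but then the Gram-Schmidt vector itself is 0 and both sides
  vanish.\<close>

lemma scalar_prod_row_gram_schmidt_row:
  "row A i \<bullet> gram_schmidt_row A j =
    gram_schmidt_mu A i j * (gram_schmidt_row A j \<bullet> gram_schmidt_row A j)"
proof (cases "gram_schmidt_row A j \<bullet> gram_schmidt_row A j = 0")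
  case True
  then have "gram_schmidt_row A j = 0\<^sub>v (dim_col A)"
    using real_scalar_prod_self_eq_0[of "gram_schmidt_row A j"] by simp
  then show ?thesis by (metis True mult_zero_right row_carrier scalar_prod_right_zero)
qed (simp add: gram_schmidt_mu_def)

lemma gram_schmidt_row_orthogonal_less:
  "j < i \<Longrightarrow> gram_schmidt_row A i \<bullet> gram_schmidt_row A j = 0"
proof (induction i arbitrary: j rule: less_induct)
  case (less i)
  let ?g = "gram_schmidt_row A" and ?mu = "gram_schmidt_mu A i"
  \<comment> \<open>Here \<open>l\<close> may lie on either side of \<open>j\<close>; the induction
    hypothesis is applied to the larger of the two indices.\<close>
  have orth: "?g l \<bullet> ?g j = 0" if "l < i" "l \<noteq> j" for l
    using less that by (metis comm_scalar_prod gram_schmidt_row_carrier nat_neq_iff)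
  have "(\<Sum>l<i. ?mu l * (?g l \<bullet> ?g j)) = (\<Sum>l<i. if l = j then ?mu j * (?g j \<bullet> ?g j) else 0)"
    by (intro sum.cong) (auto simp: orth)
  also have "\<dots> = ?mu j * (?g j \<bullet> ?g j)" using less.prems by simp
  also have "\<dots> = row A i \<bullet> ?g j"
    by (simp add: scalar_prod_row_gram_schmidt_row)
  finally show ?case using scalar_prod_row_gram_schmidt[of "?g j" A i] by simp
qed

lemma gram_schmidt_row_orthogonal:
  "i \<noteq> j \<Longrightarrow> gram_schmidt_row A i \<bullet> gram_schmidt_row A j = 0"
  by (metis comm_scalar_prod gram_schmidt_row_carrier gram_schmidt_row_orthogonal_less nat_neq_iff)

text \<open>Gram-Schmidt is a factorisation \<open>A = T * G\<close> with \<open>T\<close> unit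
  lower triangular and \<open>G * transpose_mat G\<close> diagonal, so the Gram determinant is the
  product of the diagonal entries.\<close>

lemma det_gram_eq_prod_gram_schmidt:
  "det (A * transpose_mat A) =
    (\<Prod>i<dim_row A. gram_schmidt_row A i \<bullet> gram_schmidt_row A i)"
proof -
  let ?n = "dim_row A" and ?g = "gram_schmidt_row A"
  define T where "T = mat ?n ?n (\<lambda>(i, j). if j < i then gram_schmidt_mu A i j else if j = i then 1 else 0)"
  define G where "G = mat ?n (dim_col A) (\<lambda>(i, l). ?g i $ l)"
  have T [simp]: "T \<in> carrier_mat ?n ?n" and G [simp]: "G \<in> carrier_mat ?n (dim_col A)"
    by (simp_all add: T_def G_def)
  have "A = T * G"
  proof (rule eq_matI)
    fix i l assume il: "i < dim_row (T * G)" "l < dim_col (T * G)"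
    then have i: "i < ?n" and l: "l < dim_col A" by (simp_all add: T_def G_def)
    have "(T * G) $$ (i, l) = (\<Sum>j<?n. T $$ (i, j) * G $$ (j, l))"
      using il by (simp add: scalar_prod_def atLeast0LessThan T_def G_def)
    also have "\<dots> = (\<Sum>j<?n. (if j < i then gram_schmidt_mu A i j * ?g j $ l else 0)
        + (if j = i then ?g j $ l else 0))"
      using i l by (intro sum.cong) (auto simp: T_def G_def)
    also have "\<dots> = (\<Sum>j\<in>{..<?n} \<inter> {..<i}. gram_schmidt_mu A i j * ?g j $ l) + ?g i $ l"
      using i by (simp add: sum.distrib sum.inter_restrict)
    also have "{..<?n} \<inter> {..<i} = {..<i}" using i by auto
    finally show "A $$ (i, l) = (T * G) $$ (i, l)"
      using row_eq_gram_schmidt[OF l, of i] i l by simp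
  qed (simp_all add: T_def G_def)
  have "G * transpose_mat G = mat ?n ?n (\<lambda>(i, j). if i = j then ?g i \<bullet> ?g i else 0)"
  proof (rule eq_matI)
    fix i j assume "i < dim_row (mat ?n ?n (\<lambda>(i, j). if i = j then ?g i \<bullet> ?g i else 0))"
      "j < dim_col (mat ?n ?n (\<lambda>(i, j). if i = j then ?g i \<bullet> ?g i else 0))"
    then have ij: "i < ?n" "j < ?n" by simp_all
    have "row G i = ?g i" if "i < ?n" for i
      using that by (intro eq_vecI) (simp_all add: G_def)
    then show "(G * transpose_mat G) $$ (i, j) = mat ?n ?n (\<lambda>(i, j). if i = j then ?g i \<bullet> ?g i else 0) $$ (i, j)"
      using ij carrier_matD[OF G] by (simp add: gram_schmidt_row_orthogonal)
  qed (simp_all add: G_def)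
  also have "det \<dots> = (\<Prod>i<?n. ?g i \<bullet> ?g i)"
    by (subst det_lower_triangular[of ?n])
      (auto simp: prod_list_diag_prod atLeast0LessThan intro!: prod.cong)
  finally have detG: "det (G * transpose_mat G) = (\<Prod>i<?n. ?g i \<bullet> ?g i)" .
  have detT: "det T = 1"
    by (subst det_lower_triangular[of ?n]) (auto simp: prod_list_diag_prod T_def)
  have "A * transpose_mat A = (T * G) * (transpose_mat G * transpose_mat T)"
    by (subst (1 2) \<open>A = T * G\<close>) (simp only: transpose_mult[OF T G])
  also have "\<dots> = T * (G * transpose_mat G) * transpose_mat T"
    by (smt (verit) T G assoc_mult_mat mult_carrier_mat transpose_carrier_mat)
  finally have "det (A * transpose_mat A) = det T * det (G * transpose_mat G) * det (transpose_mat T)"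
    by (metis T G det_mult mult_carrier_mat transpose_carrier_mat)
  then show ?thesis by (simp add: detT detG det_transpose[OF T])
qed

subsection \<open>LLL-reduced bases\<close>

lemma row_norm_gram_schmidt:
  "row A i \<bullet> row A i = gram_schmidt_row A i \<bullet> gram_schmidt_row A i +
    (\<Sum>j<i. (gram_schmidt_mu A i j)\<^sup>2 * (gram_schmidt_row A j \<bullet> gram_schmidt_row A j))"
proof -
  let ?g = "gram_schmidt_row A" and ?mu = "gram_schmidt_mu A i"
  have comm: "?g j \<bullet> row A i = row A i \<bullet> ?g j" for j
    by (rule comm_scalar_prod[of _ "dim_col A"]) simp_all
  have "row A i \<bullet> ?g i = ?g i \<bullet> ?g i"
    by (subst scalar_prod_row_gram_schmidt) (simp_all add: gram_schmidt_row_orthogonal)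
  then show ?thesis
    by (subst scalar_prod_row_gram_schmidt)
      (simp_all add: comm scalar_prod_row_gram_schmidt_row power2_eq_square mult.assoc)
qed

text \<open>By orthogonality the Lovasz condition bounds \<open>h \<bullet> h\<close> below by
  \<open>(3/4 - mu\<^sup>2) * (g \<bullet> g)\<close>, and \<open>mu\<^sup>2 \<le> 1/4\<close>
  leaves the factor 1/2.\<close>

lemma LLL_reduced_gram_schmidt_Suc:
  assumes "LLL_reduced A" "Suc i < dim_row A"
  shows "gram_schmidt_row A i \<bullet> gram_schmidt_row A i
    \<le> 2 * (gram_schmidt_row A (Suc i) \<bullet> gram_schmidt_row A (Suc i))"
proof -
  define g where "g = gram_schmidt_row A i"
  define h where "h = gram_schmidt_row A (Suc i)"
  define mu where "mu = gram_schmidt_mu A (Suc i) i"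
  have dims: "g \<in> carrier_vec (dim_col A)" "h \<in> carrier_vec (dim_col A)"
    by (simp_all add: g_def h_def)
  have orth: "g \<bullet> h = 0" "h \<bullet> g = 0"
    by (simp_all add: g_def h_def gram_schmidt_row_orthogonal)
  have mu: "\<bar>mu\<bar> \<le> 1 / 2" and lovasz: "3 / 4 * (g \<bullet> g) \<le> (h + mu \<cdot>\<^sub>v g) \<bullet> (h + mu \<cdot>\<^sub>v g)"
    using assms by (simp_all add: LLL_reduced_def Let_def g_def h_def mu_def)
  have "(h + mu \<cdot>\<^sub>v g) \<bullet> (h + mu \<cdot>\<^sub>v g) = h \<bullet> h + mu\<^sup>2 * (g \<bullet> g)"
    using dims orth by (simp add: add_scalar_prod_distrib[of _ "dim_col A"]
      scalar_prod_add_distrib[of _ "dim_col A"] power2_eq_square)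
  moreover have "mu\<^sup>2 \<le> 1 / 4"
    using power_mono[OF mu, of 2] by (simp add: power2_eq_square)
  then have "mu\<^sup>2 * (g \<bullet> g) \<le> 1 / 4 * (g \<bullet> g)"
    by (rule mult_right_mono[OF _ real_scalar_prod_self_nonneg])
  ultimately show ?thesis using lovasz unfolding g_def h_def by linarith
qed

lemma LLL_reduced_gram_schmidt_growth:
  assumes "LLL_reduced A" "i + l < dim_row A"
  shows "gram_schmidt_row A i \<bullet> gram_schmidt_row A i
    \<le> 2 ^ l * (gram_schmidt_row A (i + l) \<bullet> gram_schmidt_row A (i + l))"
  using assms(2)
proof (induction l)
  case (Suc l)
  then have "gram_schmidt_row A i \<bullet> gram_schmidt_row A i
      \<le> 2 ^ l * (gram_schmidt_row A (i + l) \<bullet> gram_schmidt_row A (i + l))" by simp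
  also have "\<dots> \<le> 2 ^ l * (2 * (gram_schmidt_row A (i + Suc l) \<bullet> gram_schmidt_row A (i + Suc l)))"
    using LLL_reduced_gram_schmidt_Suc[OF assms(1), of "i + l"] Suc.prems
    by (intro mult_left_mono) simp_all
  finally show ?case by simp
qed simp

text \<open>Pythagoras together with size reduction bounds the row by its own Gram-Schmidt vector;
  the geometric growth then passes from index \<open>i\<close> to \<open>j\<close>.\<close>

lemma LLL_reduced_row_norm_le:
  assumes "LLL_reduced A" "i \<le> j" "j < dim_row A"
  shows "row A i \<bullet> row A i \<le> 2 ^ j * (gram_schmidt_row A j \<bullet> gram_schmidt_row A j)"
proof -
  define n where "n l = gram_schmidt_row A l \<bullet> gram_schmidt_row A l" for l
  have n: "0 \<le> n l" for l unfolding n_def by (rule real_scalar_prod_self_nonneg)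
  have growth: "n l \<le> 2 ^ (l' - l) * n l'" if "l \<le> l'" "l' < dim_row A" for l l'
    using LLL_reduced_gram_schmidt_growth[OF assms(1), of l "l' - l"] that by (simp add: n_def)
  have "(gram_schmidt_mu A i l)\<^sup>2 * n l \<le> 1 / 4 * (2 ^ (i - l) * n i)" if "l < i" for l
  proof (rule mult_mono)
    have "\<bar>gram_schmidt_mu A i l\<bar> \<le> 1 / 2" using assms that by (simp add: LLL_reduced_def)
    then show "(gram_schmidt_mu A i l)\<^sup>2 \<le> 1 / 4"
      using power_mono[of "\<bar>gram_schmidt_mu A i l\<bar>" "1 / 2" 2] by (simp add: power2_eq_square)
  qed (use growth[of l i] assms that n in auto)
  then have "row A i \<bullet> row A i \<le> n i + (\<Sum>l<i. 1 / 4 * (2 ^ (i - l) * n i))"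
    unfolding row_norm_gram_schmidt n_def[symmetric] by (intro add_left_mono sum_mono) simp
  also have "(\<Sum>l<i. 1 / 4 * (2 ^ (i - l) * n i)) = n i / 4 * (\<Sum>l<i. 2 ^ (i - l))"
    by (simp add: sum_distrib_left mult.commute)
  also have "(\<Sum>l<i. 2 ^ (i - l) :: real) = (\<Sum>l<i. 2 ^ Suc l)"
    by (rule sum.reindex_bij_witness[of _ "\<lambda>l. i - Suc l" "\<lambda>l. i - Suc l"]) (auto simp: Suc_diff_Suc)
  also have "\<dots> = 2 * (2 ^ i - 1)" by (induction i) simp_all
  also have "n i + n i / 4 * (2 * (2 ^ i - 1)) = n i * ((2 ^ i + 1) / 2)"
    by (simp add: field_simps)
  \<comment> \<open>Rounding up to \<open>2 ^ i\<close> makes the exponents add to \<open>j\<close>,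
    so the final constant no longer depends on \<open>i\<close>.\<close>
  also have "\<dots> \<le> n i * 2 ^ i"
    using n[of i] by (intro mult_left_mono) simp_all
  also have "\<dots> \<le> 2 ^ (j - i) * n j * 2 ^ i"
    using growth[OF assms(2,3)] by (intro mult_right_mono) simp_all
  also have "\<dots> = 2 ^ j * n j"
    using assms(2) by (simp add: power_add[symmetric] mult.commute mult.left_commute)
  finally show ?thesis by (simp add: n_def)
qed

text \<open>The row estimate is multiplied over all \<open>j \<ge> i\<close>. The factors with
  \<open>j < i\<close> that the Gram determinant also contains have product at least 1 by
  assumption, so inserting them only enlarges the bound.\<close>

lemma LLL_reduced_row_norm_power_le:
  assumes "LLL_reduced A" "i < dim_row A"
    and "1 \<le> (\<Prod>j<i. gram_schmidt_row A j \<bullet> gram_schmidt_row A j)"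
  shows "(row A i \<bullet> row A i) ^ (dim_row A - i)
    \<le> 2 ^ (\<Sum>j<dim_row A. j) * det (A * transpose_mat A)"
proof -
  let ?n = "dim_row A"
  let ?g = "\<lambda>j. gram_schmidt_row A j \<bullet> gram_schmidt_row A j"
  have nonneg: "0 \<le> ?g j" for j by (rule real_scalar_prod_self_nonneg)
  have "(row A i \<bullet> row A i) ^ (?n - i) = (\<Prod>j\<in>{i..<?n}. row A i \<bullet> row A i)" by simp
  also have "\<dots> \<le> (\<Prod>j\<in>{i..<?n}. 2 ^ j * ?g j)"
    using LLL_reduced_row_norm_le[OF assms(1), of i] real_scalar_prod_self_nonneg
    by (intro prod_mono) auto
  also have "\<dots> = 2 ^ (\<Sum>j\<in>{i..<?n}. j) * (\<Prod>j\<in>{i..<?n}. ?g j)"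
    by (simp add: prod.distrib power_sum)
  also have "\<dots> \<le> 2 ^ (\<Sum>j<?n. j) * ((\<Prod>j<i. ?g j) * (\<Prod>j\<in>{i..<?n}. ?g j))"
  proof (rule mult_mono)
    show "(2 :: real) ^ (\<Sum>j\<in>{i..<?n}. j) \<le> 2 ^ (\<Sum>j<?n. j)"
      by (intro power_increasing sum_mono2) auto
    show "(\<Prod>j\<in>{i..<?n}. ?g j) \<le> (\<Prod>j<i. ?g j) * (\<Prod>j\<in>{i..<?n}. ?g j)"
      using mult_right_mono[OF assms(3), of "\<Prod>j\<in>{i..<?n}. ?g j"] nonneg by (simp add: prod_nonneg)
  qed (use nonneg in \<open>auto intro: prod_nonneg\<close>)
  also have "(\<Prod>j<i. ?g j) * (\<Prod>j\<in>{i..<?n}. ?g j) = (\<Prod>j<?n. ?g j)"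
    using assms(2) by (subst prod.union_disjoint[symmetric]) (auto intro!: prod.cong)
  finally show ?thesis by (simp add: det_gram_eq_prod_gram_schmidt)
qed

subsection \<open>Lattice determinants\<close>

lemma det_gram_mult:
  fixes U :: "'a :: comm_ring_1 mat"
  assumes U: "U \<in> carrier_mat n n" and B: "B \<in> carrier_mat n c"
  shows "det ((U * B) * transpose_mat (U * B)) = (det U)\<^sup>2 * det (B * transpose_mat B)"
proof -
  have "(U * B) * transpose_mat (U * B) = (U * B) * (transpose_mat B * transpose_mat U)"
    by (simp only: transpose_mult[OF U B])
  also have "\<dots> = U * (B * transpose_mat B) * transpose_mat U"
    by (smt (verit) U B assoc_mult_mat mult_carrier_mat transpose_carrier_mat)
  finally have "det ((U * B) * transpose_mat (U * B)) =
      det U * det (B * transpose_mat B) * det (transpose_mat U)"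
    by (metis U B det_mult mult_carrier_mat transpose_carrier_mat)
  then show ?thesis by (simp add: det_transpose[OF U] power2_eq_square)
qed

lemma row_in_row_lattice:
  assumes "i < dim_row A"
  shows "row A i \<in> row_lattice A"
proof -
  have "map_vec real_of_int (unit_vec (dim_row A) i) = unit_vec (dim_row A) i"
    by (rule eq_vecI) (auto simp: unit_vec_def)
  moreover have "transpose_mat A *\<^sub>v unit_vec (dim_row A) i = row A i"
    using assms by (intro eq_vecI) (simp_all add: scalar_prod_right_unit)
  ultimately show ?thesis unfolding row_lattice_def
    by (intro CollectI exI[of _ "unit_vec (dim_row A) i"]) simp
qed

text \<open>The integer coordinates of each row of \<open>A\<close> with respect to the rows of
  \<open>B\<close> form the rows of \<open>U\<close>.\<close>

lemma row_lattice_subset_imp_mult: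
  assumes A: "A \<in> carrier_mat k c" and B: "B \<in> carrier_mat n c"
    and sub: "row_lattice A \<subseteq> row_lattice B"
  obtains U :: "int mat" where "U \<in> carrier_mat k n" "A = map_mat of_int U * B"
proof -
  have "\<exists>x :: int vec. x \<in> carrier_vec n \<and> row A i = transpose_mat B *\<^sub>v map_vec of_int x" if "i < k" for i
    using row_in_row_lattice[of i A] that A B sub by (auto simp: row_lattice_def)
  then obtain x :: "nat \<Rightarrow> int vec" where x: "\<And>i. i < k \<Longrightarrow> x i \<in> carrier_vec n"
    "\<And>i. i < k \<Longrightarrow> row A i = transpose_mat B *\<^sub>v map_vec of_int (x i)" by metis
  define U where "U = mat k n (\<lambda>(i, j). x i $ j)"
  have "A = map_mat of_int U * B"
  proof (rule eq_matI)
    fix i l assume "i < dim_row (map_mat real_of_int U * B)" "l < dim_col (map_mat real_of_int U * B)"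
    then have i: "i < k" and l: "l < c" using B by (auto simp: U_def)
    have "A $$ (i, l) = row A i $ l" using A i l by simp
    also have "\<dots> = (\<Sum>j<n. real_of_int (x i $ j) * B $$ (j, l))"
      using x(1)[OF i] i l B by (simp add: x(2) scalar_prod_def atLeast0LessThan mult.commute)
    also have "\<dots> = (map_mat of_int U * B) $$ (i, l)"
      using i l B by (simp add: U_def scalar_prod_def atLeast0LessThan)
    finally show "A $$ (i, l) = (map_mat of_int U * B) $$ (i, l)" .
  qed (use A B in \<open>auto simp: U_def\<close>)
  then show thesis using that[of U] by (simp add: U_def)
qed

text \<open>Integer matrices \<open>U\<close> and \<open>V\<close> pass between the two systems of
  rows. Independence of the rows of \<open>A\<close> forces their product to be the identity, hence
  the determinant of \<open>U\<close> is 1 or -1 and its square disappears from the Gram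
  determinant.\<close>

lemma det_gram_lattice_basis:
  assumes A: "A \<in> carrier_mat n c" and B: "B \<in> carrier_mat n c"
    and basis: "is_lattice_basis A (row_lattice B)"
  shows "det (A * transpose_mat A) = det (B * transpose_mat B)"
proof -
  have eq: "row_lattice A = row_lattice B" using basis by (simp add: is_lattice_basis_def)
  obtain U :: "int mat" where U: "U \<in> carrier_mat n n" "A = map_mat of_int U * B"
    using row_lattice_subset_imp_mult[OF A B] eq by blast
  obtain V :: "int mat" where V: "V \<in> carrier_mat n n" "B = map_mat of_int V * A"
    using row_lattice_subset_imp_mult[OF B A] eq by blast
  define W where "W = map_mat real_of_int U * map_mat real_of_int V"
  have W: "W \<in> carrier_mat n n" using U V by (simp add: W_def)
  have "A = map_mat of_int U * (map_mat of_int V * A)" using U(2) V(2) by simp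
  also have "\<dots> = W * A"
    unfolding W_def by (rule assoc_mult_mat[symmetric]) (use U V A in auto)
  finally have WA: "W * A = A" by simp
  \<comment> \<open>The difference of these two vectors is a linear relation between the rows of
    \<open>A\<close>, since \<open>W * A = A\<close>.\<close>
  have "row W i = unit_vec n i" if i: "i < n" for i
  proof -
    let ?x = "row W i - unit_vec n i"
    have x: "?x \<in> carrier_vec n" using W i by simp
    have "transpose_mat A *\<^sub>v ?x = transpose_mat A *\<^sub>v row W i - transpose_mat A *\<^sub>v unit_vec n i"
      using A W by (intro mult_minus_distrib_mat_vec) auto
    also have "transpose_mat A *\<^sub>v unit_vec n i = row A i"
      using A i by (intro eq_vecI) (simp_all add: scalar_prod_right_unit)
    also have "transpose_mat A *\<^sub>v row W i = row (W * A) i"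
      using A W i by (intro eq_vecI) (auto intro: comm_scalar_prod[of _ n])
    also have "row (W * A) i - row A i = 0\<^sub>v c"
      unfolding WA using A by (intro eq_vecI) auto
    finally have "?x = 0\<^sub>v n" using basis x A by (simp add: is_lattice_basis_def)
    then have "\<forall>j<n. row W i $ j - unit_vec n i $ j = 0"
      using W by (metis index_minus_vec(1) index_unit_vec(3) index_zero_vec(1))
    then show ?thesis using W i by (intro eq_vecI) auto
  qed
  then have "W = 1\<^sub>m n" using W by (intro eq_rowI) auto
  then have "det W = 1" by simp
  then have "det (map_mat real_of_int U) * det (map_mat real_of_int V) = 1"
    unfolding W_def using U V by (subst (asm) det_mult[of _ n]) auto
  then have "real_of_int (det U * det V) = 1" by simp
  then have "det U * det V = 1" using of_int_eq_1_iff by blast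
  then have "(det U)\<^sup>2 = 1" by (auto simp: zmult_eq_1_iff)
  then have "(det (map_mat real_of_int U))\<^sup>2 = 1" by (simp flip: of_int_power)
  then show ?thesis
    using det_gram_mult[of "map_mat real_of_int U" n B c] U B by simp
qed

text \<open>Completing \<open>G\<close> by the row \<open>w\<close> gives a square matrix whose Gram determinant splits; its
  own determinant is read off after replacing the last column by its product with \<open>w\<close>.\<close>

lemma det_gram_kernel_vector:
  fixes G :: "real mat"
  assumes G: "G \<in> carrier_mat n (n + 1)" and w: "w \<in> carrier_vec (n + 1)"
    and Gw: "G *\<^sub>v w = 0\<^sub>v n" and "w $ n \<noteq> 0"
  shows "(w $ n)\<^sup>2 * det (G * transpose_mat G) =
    (w \<bullet> w) * (det (mat n n (\<lambda>(i, j). G $$ (i, j))))\<^sup>2"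
proof -
  define M where "M = mat (n + 1) (n + 1) (\<lambda>(i, j). if i < n then G $$ (i, j) else w $ j)"
  define Q where "Q = mat (n + 1) (n + 1) (\<lambda>(i, j). if j < n then (if i = j then 1 else 0) else w $ i)"
  let ?H = "mat n n (\<lambda>(i, j). G $$ (i, j))"
  have M: "M \<in> carrier_mat (n + 1) (n + 1)" and Q: "Q \<in> carrier_mat (n + 1) (n + 1)"
    by (simp_all add: M_def Q_def)
  have rowM: "row M i = (if i < n then row G i else w)" if "i < n + 1" for i
    using that G w by (intro eq_vecI) (auto simp: M_def)
  have Gw0: "row G i \<bullet> w = 0" if "i < n" for i
    using arg_cong[OF Gw, of "\<lambda>v. v $ i"] that G by simp
  have wG0: "w \<bullet> row G i = 0" if "i < n" for i
    using Gw0[OF that] comm_scalar_prod[of w "n + 1" "row G i"] w G that by (metis row_carrier_vec)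
  have colQ: "col Q j = (if j < n then unit_vec (n + 1) j else w)" if "j < n + 1" for j
    using that w by (intro eq_vecI) (auto simp: Q_def)
  have "det Q = (\<Prod>i<n + 1. if i < n then 1 else w $ i)"
    by (subst det_upper_triangular[of _ "n + 1"])
      (auto simp: Q_def prod_list_diag_prod atLeast0LessThan intro!: prod.cong)
  then have detQ: "det Q = w $ n" by simp
  \<comment> \<open>The last column of the product is \<open>M *\<^sub>v w\<close>, which vanishes
    above its last entry because \<open>w\<close> is orthogonal to the rows of \<open>G\<close>; the
    same orthogonality makes the Gram matrix of \<open>M\<close> block diagonal.\<close>
  have "M * Q = four_block_mat ?H (0\<^sub>m n 1) (mat 1 n (\<lambda>(i, j). w $ j)) (mat 1 1 (\<lambda>_. w \<bullet> w))"
    by (rule eq_matI) (use M Q G w Gw0 in \<open>auto simp: rowM colQ scalar_prod_right_unit less_Suc_eq\<close>)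
  then have "det (M * Q) = det ?H * det (mat 1 1 (\<lambda>_. w \<bullet> w))"
    by (simp only:) (rule det_four_block_mat_upper_right_zero, auto)
  then have detM: "det M * w $ n = det ?H * (w \<bullet> w)"
    using det_mult[OF M Q] detQ by (simp add: det_single)
  have "M * transpose_mat M =
      four_block_mat (G * transpose_mat G) (0\<^sub>m n 1) (0\<^sub>m 1 n) (mat 1 1 (\<lambda>_. w \<bullet> w))"
    by (rule eq_matI) (use M G w Gw0 wG0 in \<open>auto simp: rowM less_Suc_eq\<close>)
  then have "det (M * transpose_mat M) = det (G * transpose_mat G) * det (mat 1 1 (\<lambda>_. w \<bullet> w))"
    by (simp only:) (rule det_four_block_mat_upper_right_zero, use G in auto)
  then have "(det M)\<^sup>2 = det (G * transpose_mat G) * (w \<bullet> w)"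
    using M by (simp add: det_mult[of _ "n + 1"] det_transpose[OF M] power2_eq_square det_single)
  \<comment> \<open>The two formulas for \<open>det M\<close> are joined with an extra factor
    \<open>w \<bullet> w\<close>, cancelled at the end: it is nonzero since \<open>w $ n\<close>
    is.\<close>
  then have "(w \<bullet> w) * ((w $ n)\<^sup>2 * det (G * transpose_mat G)) = (det M * w $ n)\<^sup>2"
    by (simp add: power2_eq_square)
  also have "\<dots> = (w \<bullet> w) * ((w \<bullet> w) * (det ?H)\<^sup>2)"
    unfolding detM by (simp add: power2_eq_square)
  finally show ?thesis
    using assms(4) w real_scalar_prod_self_eq_0[of w]
    by (metis add_gr_0 carrier_vecD index_zero_vec(1) less_add_one mult_cancel_left)
qed

subsection \<open>The lattice of Algorithm B\<close>

text \<open>Reversing the columns turns the minor obtained by deleting column 0 into the leading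
  minor, as the kernel vector lemma expects, and leaves the Gram matrix unchanged.\<close>

lemma gram_reverse_columns:
  assumes A: "A \<in> carrier_mat n (d + 1)"
  defines "A' \<equiv> mat n (d + 1) (\<lambda>(i, j). A $$ (i, d - j))"
  shows "A' * transpose_mat A' = A * transpose_mat A"
proof (rule eq_matI)
  fix i j assume "i < dim_row (A * transpose_mat A)" "j < dim_col (A * transpose_mat A)"
  then have ij: "i < n" "j < n" using A by simp_all
  have "(A' * transpose_mat A') $$ (i, j) = (\<Sum>l\<in>{0..<d + 1}. A $$ (i, d - l) * A $$ (j, d - l))"
    using ij unfolding A'_def by (simp add: scalar_prod_def del: sum.op_ivl_Suc)
  also have "\<dots> = (\<Sum>l\<in>{0..<d + 1}. A $$ (i, l) * A $$ (j, l))"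
    by (rule sum.reindex_bij_witness[of _ "\<lambda>l. d - l" "\<lambda>l. d - l"]) auto
  also have "\<dots> = (A * transpose_mat A) $$ (i, j)"
    using ij A by (simp add: scalar_prod_def del: sum.op_ivl_Suc)
  finally show "(A' * transpose_mat A') $$ (i, j) = (A * transpose_mat A) $$ (i, j)" .
qed (use A in \<open>simp_all add: A'_def\<close>)

lemma coeff_monom_mult_linear:
  "coeff (monom 1 e * [:- m, p:]) j = (if j = e then - m else if j = Suc e then p else (0 :: int))"
  by (auto simp: coeff_monom_mult coeff_pCons simp del: mult_pCons_right split: nat.splits)

text \<open>This makes \<open>k div g\<close> exact in \<open>algB_start\<close>. The gcd divides
  \<open>a\<close> and \<open>a * m ^ d - k * N\<close>, hence \<open>k * N\<close>; as a divisor of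
  \<open>a\<close> it is coprime to \<open>N\<close>.\<close>

lemma algB_gcd_dvd_k:
  fixes a p m k N :: int
  assumes "gcd (a * p) N = 1" and "p dvd a * m ^ d - k * N"
  shows "algB_gcd d a p m k N dvd k"
proof -
  let ?g = "algB_gcd d a p m k N"
  have "?g dvd (a * m ^ d - k * N) div p" by (simp add: algB_gcd_def)
  then have "?g dvd a * m ^ d - k * N" using assms(2)
    by (metis dvd_mult dvd_div_mult_self dvd_mult2)
  moreover have ga: "?g dvd a" by (simp add: algB_gcd_def)
  ultimately have "?g dvd k * N"
    by (metis dvd_diff_right_iff dvd_mult2)
  moreover have "coprime ?g N"
    using assms(1) ga by (metis coprime_divisors coprime_iff_gcd_eq_1 coprime_mult_left_iff dvd_refl)
  ultimately show ?thesis by (simp add: coprime_dvd_mult_left_iff)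
qed

lemma algB_start_top_coeff:
  "coeff (algB_start d a p m k N) d = a div algB_gcd d a p m k N"
  by (simp add: algB_start_def Let_def coeff_algA)

text \<open>The point is that dividing \<open>a\<close> and \<open>k\<close> by the gcd preserves
  the divisibility by \<open>p\<close> that Algorithm A requires of its input.\<close>

lemma algB_start_eval:
  fixes a p m k N :: int
  assumes "d \<ge> 2" "m \<noteq> 0" "p \<noteq> 0" "a \<noteq> 0" "gcd m p = 1" "gcd (a * p) N = 1"
    and "p dvd a * m ^ d - k * N"
  shows "(\<Sum>i\<le>d. coeff (algB_start d a p m k N) i * m ^ i * p ^ (d - i)) =
    k div algB_gcd d a p m k N * N"
proof -
  define g where "g = algB_gcd d a p m k N"
  have g: "g dvd a" "g dvd (a * m ^ d - k * N) div p" "g dvd k" "g \<noteq> 0"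
    using algB_gcd_dvd_k[OF assms(6,7)] assms(4) by (simp_all add: g_def algB_gcd_def)
  obtain a' k' c' where eqs: "a = g * a'" "k = g * k'" "(a * m ^ d - k * N) div p = g * c'"
    using g by (metis dvdE)
  have "a * m ^ d - k * N = p * (g * c')" using assms(7) eqs(3) by (metis dvd_mult_div_cancel)
  \<comment> \<open>The gcd divides the quotient by \<open>p\<close>, so it cancels without touching
    the factor \<open>p\<close>, whether or not it is coprime to \<open>p\<close>.\<close>
  then have "g * (k' * N - a' * m ^ d) = g * (p * (- c'))"
    unfolding eqs(1,2) by (simp add: algebra_simps)
  then have "k' * N - a' * m ^ d = p * (- c')" using g(4) by (metis mult_left_cancel)
  then have "p dvd k' * N - a' * m ^ d" by simp
  moreover have "a div g = a'" "k div g = k'" using g(4) eqs(1,2) by simp_all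
  ultimately show ?thesis
    using assms(1,2,5) unfolding algB_start_def g_def[symmetric] Let_def
    by (intro algA_correct) (auto simp: coprime_iff_gcd_eq_1)
qed

text \<open>Up to the factor \<open>p\<close>, the vector \<open>c\<close> is \<open>a\<close> times
  the homogeneous evaluation at \<open>m/p\<close>, corrected by \<open>- k * N\<close> in the last
  entry. The rows from \<open>p x - m\<close> vanish there; for the first row the correction cancels
  the value of the polynomial.\<close>

lemma algB_matrix_c_vec_orthogonal:
  fixes a p m k N :: int
  assumes "d \<ge> 2" "m \<noteq> 0" "p \<noteq> 0" "a \<noteq> 0" "gcd m p = 1" "gcd (a * p) N = 1"
    and "p dvd a * m ^ d - k * N" and i: "i < d"
  shows "(\<Sum>j\<le>d. algB_matrix d a p m k N $$ (i, j) * c_vec d a p m k N $ j) = 0"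
proof (cases "i = 0")
  case True
  define g where "g = algB_gcd d a p m k N"
  define b where "b = coeff (algB_start d a p m k N)"
  have g: "g dvd a" "g dvd k"
    using algB_gcd_dvd_k[OF assms(6,7)] by (simp_all add: g_def algB_gcd_def)
  have pc: "p * c_vec d a p m k N $ j = a * (m ^ j * p ^ (d - j)) - (if j = d then k * N else 0)"
    if "j \<le> d" for j
  proof (cases "j = d")
    case False
    then have "d - j = Suc (d - 1 - j)" using that by simp
    then show ?thesis using that False by (simp add: c_vec_def)
  qed (use assms(7) in \<open>simp add: c_vec_def\<close>)
  have "p * (\<Sum>j\<le>d. algB_matrix d a p m k N $$ (i, j) * c_vec d a p m k N $ j)
      = (\<Sum>j\<le>d. b j * (p * c_vec d a p m k N $ j))"
    unfolding sum_distrib_left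
    using True assms(1) by (intro sum.cong) (auto simp: algB_matrix_def b_def)
  also have "\<dots> = (\<Sum>j\<le>d. a * (b j * m ^ j * p ^ (d - j)) - (if j = d then b j * (k * N) else 0))"
    by (intro sum.cong) (auto simp: pc algebra_simps)
  also have "\<dots> = a * (\<Sum>j\<le>d. b j * m ^ j * p ^ (d - j)) - b d * (k * N)"
    by (simp add: sum_subtractf sum_distrib_left)
  also have "\<dots> = a * (k div g * N) - a div g * (k * N)"
    using algB_start_eval[OF assms(1-7)] algB_start_top_coeff[of d a p m k N]
    by (simp add: b_def g_def)
  also have "\<dots> = 0" using g by (auto elim!: dvdE)
  finally show ?thesis using assms(3) by simp
next
  case False
  define e where "e = d - 1 - i"
  \<comment> \<open>Positions \<open>e\<close> and \<open>Suc e\<close> both stay below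
    \<open>d\<close>, so the exceptional last entry of \<open>c\<close> is not met and consecutive
    entries have ratio \<open>m / p\<close>.\<close>
  have e: "Suc e < d" using False i by (simp add: e_def)
  have "(\<Sum>j\<le>d. algB_matrix d a p m k N $$ (i, j) * c_vec d a p m k N $ j) =
    (\<Sum>j\<le>d. (if j = e then - m * c_vec d a p m k N $ j else 0) +
      (if j = Suc e then p * c_vec d a p m k N $ j else 0))"
    using False i by (intro sum.cong) (auto simp: algB_matrix_def coeff_monom_mult_linear e_def simp del: mult_pCons_right)
  also have "\<dots> = - m * c_vec d a p m k N $ e + p * c_vec d a p m k N $ Suc e"
    using e by (simp add: sum.distrib)
  also have "\<dots> = 0"
  proof -
    have "d - 1 - e = Suc (d - 1 - Suc e)" using e by simp
    then show ?thesis using e by (simp add: c_vec_def)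
  qed
  finally show ?thesis .
qed

text \<open>The kernel vector lemma is applied to the reversed matrix. Orthogonality of
  \<open>B\<close> to \<open>c\<close> becomes orthogonality of \<open>B * S\<close> to the entries
  of \<open>c\<close> divided by \<open>s ^ j\<close>.\<close>

lemma det_gram_algB:
  fixes a p m k N s :: int
  assumes "d \<ge> 2" "m \<noteq> 0" "p \<noteq> 0" "a \<noteq> 0" "gcd m p = 1" "gcd (a * p) N = 1"
    and "p dvd a * m ^ d - k * N" and "s > 0"
  defines "G \<equiv> map_mat real_of_int (algB_matrix d a p m k N * skew_matrix d s)"
  shows "det (G * transpose_mat G) = (real_of_int s ^ (\<Sum>i<d. d - i))\<^sup>2 / (of_int (algB_gcd d a p m k N))\<^sup>2 *
    (\<Sum>j\<le>d. (of_int (c_vec d a p m k N $ j) / of_int s ^ j)\<^sup>2)"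
proof -
  define B where "B = algB_matrix d a p m k N"
  define c where "c = c_vec d a p m k N"
  define g where "g = algB_gcd d a p m k N"
  define G' where "G' = mat d (d + 1) (\<lambda>(i, j). G $$ (i, d - j))"
  define w where "w = vec (d + 1) (\<lambda>j. real_of_int (c $ (d - j)) / of_int s ^ (d - j))"
  define H where "H = mat d d (\<lambda>(i, j). G' $$ (i, j))"
  have B: "B \<in> carrier_mat d (d + 1)" by (simp add: B_def algB_matrix_def)
  have G_index: "G $$ (i, j) = of_int (B $$ (i, j)) * of_int s ^ j" if "i < d" "j < d + 1" for i j
    using that B unfolding G_def skew_matrix_def B_def[symmetric]
    by (subst mat_diag_mult_right[OF B]) simp
  have G: "G \<in> carrier_mat d (d + 1)"
    using B by (simp add: G_def B_def skew_matrix_def mat_diag_def)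
  have w_norm: "w \<bullet> w = (\<Sum>j\<le>d. (of_int (c $ j) / of_int s ^ j)\<^sup>2)"
  proof -
    have "w \<bullet> w = (\<Sum>j\<le>d. (of_int (c $ (d - j)) / of_int s ^ (d - j))\<^sup>2)"
      unfolding scalar_prod_def by (rule sum.cong) (auto simp: w_def power2_eq_square)
    also have "\<dots> = (\<Sum>j\<le>d. (of_int (c $ j) / of_int s ^ j)\<^sup>2)"
      by (rule sum.reindex_bij_witness[of _ "\<lambda>l. d - l" "\<lambda>l. d - l"]) auto
    finally show ?thesis .
  qed
  have "G' *\<^sub>v w = 0\<^sub>v d"
  proof (rule eq_vecI)
    fix i assume "i < dim_vec (0\<^sub>v d :: real vec)"
    then have i: "i < d" by simp
    have "(G' *\<^sub>v w) $ i = (\<Sum>j\<le>d. of_int (B $$ (i, d - j)) * of_int (c $ (d - j)))"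
      using i assms(8) unfolding mult_mat_vec_def G'_def scalar_prod_def
      by (simp del: sum.op_ivl_Suc, intro sum.cong) (auto simp: G_index w_def)
    also have "\<dots> = (\<Sum>j\<le>d. real_of_int (B $$ (i, j)) * of_int (c $ j))"
      by (rule sum.reindex_bij_witness[of _ "\<lambda>l. d - l" "\<lambda>l. d - l"]) auto
    also have "\<dots> = of_int (\<Sum>j\<le>d. B $$ (i, j) * c $ j)" by simp
    also have "\<dots> = 0"
      using algB_matrix_c_vec_orthogonal[OF assms(1-7) i] by (simp add: B_def c_def)
    finally show "(G' *\<^sub>v w) $ i = 0\<^sub>v d $ i" using i by simp
  qed (simp add: G'_def)
  moreover have wd: "w $ d = of_int (a * p ^ (d - 1))"
    using assms(1) by (simp add: w_def c_def c_vec_def)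
  moreover have "w $ d \<noteq> 0" using wd assms(3,4) by simp
  ultimately have main: "(w $ d)\<^sup>2 * det (G' * transpose_mat G') = (w \<bullet> w) * (det H)\<^sup>2"
    unfolding H_def by (intro det_gram_kernel_vector) (auto simp: G'_def w_def)
  have H_index: "H $$ (i, j) = of_int (B $$ (i, d - j)) * of_int s ^ (d - j)" if "i < d" "j < d" for i j
    using that by (simp add: H_def G'_def G_index)
  have B_index: "B $$ (i, d - j) = (if i = 0 then coeff (algB_start d a p m k N) (d - j)
      else if j = Suc i then - m else if j = i then p else 0)" if "i < d" "j < d" for i j
    using that by (auto simp: B_def algB_matrix_def coeff_monom_mult_linear simp del: mult_pCons_right)
  have H: "H \<in> carrier_mat d d" by (simp add: H_def)
  \<comment> \<open>After reversal each row from \<open>p x - m\<close> has \<open>p\<close> on the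
    diagonal and \<open>- m\<close> just to its right, when that column belongs to \<open>H\<close>;
    the full row comes first, with diagonal entry \<open>a div g\<close> times
    \<open>s ^ d\<close>.\<close>
  have "upper_triangular H"
    using H by (intro upper_triangularI) (auto simp: H_index B_index)
  then have "det H = (\<Prod>i<d. H $$ (i, i))"
    using H det_upper_triangular[of H d] by (simp add: prod_list_diag_prod atLeast0LessThan)
  also have "\<dots> = (\<Prod>i<d. (if i = 0 then of_int (a div g) else of_int p) * of_int s ^ (d - i))"
    by (intro prod.cong) (auto simp: H_index B_index algB_start_top_coeff g_def)
  also have "\<dots> = (\<Prod>i<d. if i = 0 then real_of_int (a div g) else of_int p) * of_int s ^ (\<Sum>i<d. d - i)"
    by (simp add: prod.distrib power_sum)
  also have "(\<Prod>i<d. if i = 0 then real_of_int (a div g) else of_int p) =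
      of_int (a div g) * of_int p ^ (d - 1)"
  proof -
    obtain n where "d = Suc n" using assms(1) by (cases d) auto
    then show ?thesis by (simp add: prod.lessThan_Suc_shift del: prod.lessThan_Suc)
  qed
  also have "real_of_int (a div g) = of_int a / of_int g"
    by (rule real_of_int_div) (simp add: g_def algB_gcd_def)
  finally have detH: "det H = of_int a / of_int g * of_int p ^ (d - 1) * of_int s ^ (\<Sum>i<d. d - i)" .
  \<comment> \<open>This is the entry \<open>w $ d\<close>, that is \<open>c $ 0\<close>; it also
    divides out of \<open>det H\<close>, leaving only \<open>1 / g\<close> and the power of
    \<open>s\<close>.\<close>
  define q where "q = real_of_int a * of_int p ^ (d - 1)"
  define S where "S = real_of_int s ^ (\<Sum>i<d. d - i)"
  have "q \<noteq> 0" using assms(3,4) by (simp add: q_def)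
  have "q\<^sup>2 * det (G' * transpose_mat G') = (w \<bullet> w) * (q / of_int g * S)\<^sup>2"
    using main unfolding detH wd by (simp add: q_def S_def)
  also have "\<dots> = q\<^sup>2 * (S\<^sup>2 / (of_int g)\<^sup>2 * (w \<bullet> w))"
    by (simp add: power_mult_distrib power_divide)
  finally have "det (G' * transpose_mat G') = S\<^sup>2 / (of_int g)\<^sup>2 * (w \<bullet> w)"
    using \<open>q \<noteq> 0\<close> by (metis mult_left_cancel power_not_zero)
  then show ?thesis
    unfolding G'_def gram_reverse_columns[OF G] w_norm by (simp add: S_def g_def c_def)
qed

text \<open>A basis row is a nonzero integer vector, so its squared norm is a positive
  integer.\<close>

lemma int_lattice_basis_norm_ge_1:
  fixes C :: "int mat"
  assumes R: "R \<in> carrier_mat n c" and C: "C \<in> carrier_mat n c"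
    and basis: "is_lattice_basis R (row_lattice (map_mat of_int C))" and i: "i < n"
  shows "1 \<le> row R i \<bullet> row R i"
proof -
  have C': "map_mat real_of_int C \<in> carrier_mat n c" using C by simp
  have "row_lattice R \<subseteq> row_lattice (map_mat of_int C)"
    using basis by (simp add: is_lattice_basis_def)
  from row_lattice_subset_imp_mult[OF R C' this] obtain U :: "int mat"
    where U: "U \<in> carrier_mat n n" "R = map_mat of_int U * map_mat of_int C" by blast
  then have RUC: "R = map_mat of_int (U * C)"
    using of_int_hom.mat_hom_mult[OF U(1) C] by metis
  have "row R i \<bullet> row R i = of_int (row (U * C) i \<bullet> row (U * C) i)"
    using U(1) C i unfolding RUC by (simp add: scalar_prod_def)
  moreover have "row R i \<bullet> row R i \<noteq> 0"
  proof
    assume "row R i \<bullet> row R i = 0"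
    then have "row R i = 0\<^sub>v c" using real_scalar_prod_self_eq_0[of "row R i"] R by simp
    moreover have "transpose_mat R *\<^sub>v unit_vec n i = row R i"
      using R i by (intro eq_vecI) (simp_all add: scalar_prod_right_unit)
    ultimately have "unit_vec n i = (0\<^sub>v n :: real vec)"
      using basis R by (simp add: is_lattice_basis_def)
    then show False using i by (metis index_unit_vec(1) index_zero_vec(1) zero_neq_one)
  qed
  ultimately show ?thesis using real_scalar_prod_self_nonneg[of "row R i"] by simp
qed

section \<open>Skewed norms of the returned polynomials and the final bound\<close>

lemma poly_skew_norm_eq:
  assumes "s > 0" and f: "f = (\<Sum>j\<le>d. monom (b $ j) j)"
    and v: "v \<in> carrier_vec (d + 1)" "\<And>j. j \<le> d \<Longrightarrow> v $ j = s ^ j * b $ j"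
  shows "poly_skew_norm s f = s powr (- (real (degree f) / 2)) * sqrt (v \<bullet> v)"
proof -
  have coeff_f: "coeff f j = (if j \<le> d then b $ j else 0)" for j
    unfolding f by (simp add: coeff_sum sum.delta)
  then have deg: "degree f \<le> d" by (intro degree_le) simp
  have "s powr (real i - real (degree f) / 2) = s powr (- (real (degree f) / 2)) * s ^ i" for i
    using assms(1) by (simp add: powr_add[symmetric] flip: powr_realpow)
  then have "(\<Sum>i\<le>degree f. \<bar>coeff f i * s powr (real i - real (degree f) / 2)\<bar>\<^sup>2)
      = (\<Sum>i\<le>degree f. (s powr (- (real (degree f) / 2)))\<^sup>2 * (coeff f i * s ^ i)\<^sup>2)"
    by (simp add: power_mult_distrib mult.left_commute)
  also have "\<dots> = (s powr (- (real (degree f) / 2)))\<^sup>2 * (\<Sum>i\<le>degree f. (coeff f i * s ^ i)\<^sup>2)"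
    by (simp add: sum_distrib_left)
  \<comment> \<open>The degree of \<open>f\<close> may be smaller than \<open>d\<close>; the
    additional terms are 0.\<close>
  also have "(\<Sum>i\<le>degree f. (coeff f i * s ^ i)\<^sup>2) = (\<Sum>i\<le>d. (coeff f i * s ^ i)\<^sup>2)"
    using deg by (intro sum.mono_neutral_left) (auto simp: coeff_eq_0)
  also have "\<dots> = v \<bullet> v"
    unfolding scalar_prod_def using v
    by (intro sum.cong) (auto simp: coeff_f power2_eq_square)
  finally show ?thesis by (simp add: poly_skew_norm_def real_sqrt_mult)
qed

lemma le_powr_inverse_of_power_le:
  fixes x y :: real
  assumes "0 \<le> x" "n > 0" "x ^ n \<le> y"
  shows "x \<le> y powr (1 / real n)"
proof -
  have "x = (x ^ n) powr (1 / real n)"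
    using assms(1,2) by (cases "x = 0") (simp_all add: powr_powr flip: powr_realpow)
  also have "\<dots> \<le> y powr (1 / real n)" using assms by (intro powr_mono2) simp_all
  finally show ?thesis .
qed

theorem theorem4p6:
  fixes d :: nat and a p m k N s a_tilde :: int and c :: "int vec" and f :: "nat \<Rightarrow> real poly"
  assumes "d \<ge> 2"
    and "a \<noteq> 0" and "p \<noteq> 0" and "m \<noteq> 0" and "k \<noteq> 0" and "N > 0"
    and "gcd m p = 1" and "gcd (a * p) N = 1"
    and "p dvd a * m ^ d - k * N" and "(a * m ^ d - k * N) div p \<noteq> 0"
    and "s > 0"
    and "algB_output d a p m k N s f"
    and "c = c_vec d a p m k N"
    and "a_tilde = a div gcd a (c $ d)"
  shows "\<forall>i \<in> {1, 2}. poly_skew_norm (real_of_int s) (f i)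
    \<le> real_of_int s powr (- (real (degree (f i)) / 2)) *
       (2 powr (real d * (real d - 1) / 4) * real_of_int s powr (real d ^ 2 / 2)
        * (real_of_int a_tilde / real_of_int a)
        * vec_inv_skew_norm (real_of_int s) (map_vec real_of_int c))
       powr (1 / (real d - real i + 1))"
proof
  fix i :: nat assume i: "i \<in> {1, 2}"
  define C where "C = algB_matrix d a p m k N * skew_matrix d s"
  define G where "G = map_mat real_of_int C"
  define g where "g = algB_gcd d a p m k N"
  define W where "W = (\<Sum>j\<le>d. (real_of_int (c $ j) / of_int s ^ j)\<^sup>2)"
  \<comment> \<open>The bracket of the claim without its power of 2; it will be identified with the
    square root of the Gram determinant of the lattice.\<close>
  define K where "K = real_of_int s powr (real d ^ 2 / 2) * (real_of_int a_tilde / real_of_int a)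
    * vec_inv_skew_norm (real_of_int s) (map_vec real_of_int c)"
  have C: "C \<in> carrier_mat d (d + 1)"
    unfolding C_def by (rule mult_carrier_mat[of _ _ "d + 1"]) (simp_all add: algB_matrix_def skew_matrix_def mat_diag_def)
  have s: "real_of_int s > 0" using assms(11) by simp
  from assms(12) obtain R where R: "R \<in> carrier_mat d (d + 1)"
    and basis: "is_lattice_basis R (row_lattice G)" and red: "LLL_reduced R"
    and out: "\<forall>i \<in> {1, 2}. \<exists>b \<in> carrier_vec (d + 1).
       row R (i - 1) = transpose_mat (map_mat of_int (skew_matrix d s)) *\<^sub>v b \<and>
       f i = (\<Sum>j\<le>d. monom (b $ j) j)"
    unfolding algB_output_def C_def G_def by blast
  obtain b where b: "b \<in> carrier_vec (d + 1)"
    "row R (i - 1) = transpose_mat (map_mat of_int (skew_matrix d s)) *\<^sub>v b"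
    "f i = (\<Sum>j\<le>d. monom (b $ j) j)" using out i by blast
  define x where "x = sqrt (row R (i - 1) \<bullet> row R (i - 1))"
  have x: "0 \<le> x" "x\<^sup>2 = row R (i - 1) \<bullet> row R (i - 1)"
    by (simp_all add: x_def real_scalar_prod_self_nonneg)
  have row_R: "row R (i - 1) \<in> carrier_vec (d + 1)"
    by (rule carrier_vecI) (simp only: index_row(2) carrier_matD(2)[OF R])
  have "row R (i - 1) $ j = of_int s ^ j * b $ j" if "j \<le> d" for j
  proof -
    let ?T = "transpose_mat (map_mat real_of_int (skew_matrix d s))"
    have "row ?T j = of_int s ^ j \<cdot>\<^sub>v unit_vec (d + 1) j"
      using that by (intro eq_vecI) (auto simp: skew_matrix_def mat_diag_def)
    moreover have "row R (i - 1) $ j = row ?T j \<bullet> b"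
      unfolding b(2) using that by (simp add: skew_matrix_def mat_diag_def)
    ultimately show ?thesis using that b(1) by (simp add: scalar_prod_left_unit)
  qed
  then have norm_f: "poly_skew_norm (real_of_int s) (f i) = real_of_int s powr (- (real (degree (f i)) / 2)) * x"
    unfolding x_def by (rule poly_skew_norm_eq[OF s b(3) row_R])

  have det_G: "det (G * transpose_mat G) = (real_of_int s ^ (\<Sum>i<d. d - i))\<^sup>2 / (of_int g)\<^sup>2 * W"
    using det_gram_algB[OF assms(1,4,3,2,7,8,9,11)] by (simp add: G_def C_def g_def W_def assms(13))
  have "a_tilde = a div g"
    using assms(1) by (simp add: assms(13,14) g_def algB_gcd_def c_vec_def)
  then have a_tilde: "real_of_int a_tilde / of_int a = 1 / of_int g"
    using assms(2) by (simp add: real_of_int_div g_def algB_gcd_def)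
  have "g > 0" using assms(2) by (simp add: g_def algB_gcd_def)
  have "(\<Sum>i\<le>d. (map_vec real_of_int c $ i)\<^sup>2 * real_of_int s powr (- 2 * real i)) = W"
    unfolding W_def
  proof (intro sum.cong refl)
    fix j assume "j \<in> {..d}"
    then have "map_vec real_of_int c $ j = of_int (c $ j)" by (simp add: assms(13) c_vec_def)
    moreover have "real_of_int s powr (- 2 * real j) = 1 / (of_int s ^ j)\<^sup>2"
      using powr_realpow[OF s, of "2 * j"] powr_minus_divide[of "real_of_int s" "2 * real j"]
      by (simp add: power_even_eq)
    ultimately show "(map_vec real_of_int c $ j)\<^sup>2 * real_of_int s powr (- 2 * real j) =
        (of_int (c $ j) / of_int s ^ j)\<^sup>2" by (simp add: power_divide)
  qed
  then have "vec_inv_skew_norm (real_of_int s) (map_vec real_of_int c) = of_int s powr (real d / 2) * sqrt W"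
    by (simp add: vec_inv_skew_norm_def assms(13) c_vec_def Let_def)
  then have K: "K = of_int s powr (real d ^ 2 / 2) * (of_int s powr (real d / 2)) / of_int g * sqrt W"
    unfolding K_def a_tilde by simp
  have gauss: "2 * (\<Sum>i<n. n - i) = n * (n + 1)" for n :: nat
  proof -
    have "(\<Sum>i<n. n - i) = (\<Sum>i<n. Suc i)"
      by (rule sum.reindex_bij_witness[of _ "\<lambda>i. n - Suc i" "\<lambda>i. n - Suc i"]) auto
    also have "2 * \<dots> = n * (n + 1)" by (induction n) simp_all
    finally show ?thesis .
  qed
  \<comment> \<open>The exponent \<open>d(d+1)/2\<close> splits into \<open>d\<^sup>2/2\<close>,
    explicit in the bound, and \<open>d/2\<close>, hidden in the normalisation of
    \<open>vec_inv_skew_norm\<close>.\<close>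
  have "real (\<Sum>i<d. d - i) = real d ^ 2 / 2 + real d / 2"
    using arg_cong[OF gauss[of d], of real] by (simp add: power2_eq_square field_simps)
  then have "real_of_int s ^ (\<Sum>i<d. d - i) = of_int s powr (real d ^ 2 / 2) * of_int s powr (real d / 2)"
    using s by (simp add: powr_realpow[symmetric] powr_add)
  then have K2: "K = of_int s ^ (\<Sum>i<d. d - i) / of_int g * sqrt W" by (simp add: K)
  have "0 \<le> W" by (simp add: W_def sum_nonneg)
  have K_sq: "K\<^sup>2 = det (G * transpose_mat G)"
    unfolding det_G K2 using \<open>0 \<le> W\<close> by (simp add: power_mult_distrib power_divide)
  have "0 \<le> K" unfolding K2 using s \<open>g > 0\<close> \<open>0 \<le> W\<close> by simp

  have "1 \<le> row R 0 \<bullet> row R 0"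
    using int_lattice_basis_norm_ge_1[OF R C] basis assms(1) by (simp add: G_def)
  \<comment> \<open>For \<open>i = 1\<close> the product is empty; for \<open>i = 2\<close> its only
    factor is the squared norm of row 0, which is its own Gram-Schmidt vector.\<close>
  then have "1 \<le> (\<Prod>j<i - 1. gram_schmidt_row R j \<bullet> gram_schmidt_row R j)"
    using i row_norm_gram_schmidt[of R 0] by auto
  then have "(x\<^sup>2) ^ (d - (i - 1)) \<le> 2 ^ (\<Sum>j<d. j) * det (R * transpose_mat R)"
    using LLL_reduced_row_norm_power_le[OF red, of "i - 1"] R i assms(1) by (auto simp: x)
  also have "det (R * transpose_mat R) = K\<^sup>2"
    unfolding K_sq using R C basis by (intro det_gram_lattice_basis) (auto simp: G_def)
  \<comment> \<open>The exponent is \<open>d(d-1)/2\<close>; writing the power as a square prepares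
    for taking square roots, which halves it to \<open>d(d-1)/4\<close>.\<close>
  also have "(2 :: real) ^ (\<Sum>j<d. j) = (2 powr (real d * (real d - 1) / 4))\<^sup>2"
  proof -
    have "real (\<Sum>j<n. j) = real n * (real n - 1) / 2" for n
      by (induction n) (simp_all add: field_simps)
    then have "real (\<Sum>j<d. j) = real d * (real d - 1) / 4 + real d * (real d - 1) / 4" by simp
    then show ?thesis
      using powr_realpow[of 2 "\<Sum>j<d. j"] by (simp only: powr_add power2_eq_square)
  qed
  finally have "(x ^ (d - (i - 1)))\<^sup>2 \<le> (2 powr (real d * (real d - 1) / 4) * K)\<^sup>2"
    by (simp add: power_mult_distrib power_mult[symmetric] mult.commute)
  then have "x ^ (d - (i - 1)) \<le> 2 powr (real d * (real d - 1) / 4) * K"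
    by (rule power2_le_imp_le) (simp add: \<open>0 \<le> K\<close>)
  then have "x \<le> (2 powr (real d * (real d - 1) / 4) * K) powr (1 / real (d - (i - 1)))"
    using i assms(1) by (intro le_powr_inverse_of_power_le[OF x(1)]) auto
  also have "real (d - (i - 1)) = real d - real i + 1" using i assms(1) by auto
  finally show "poly_skew_norm (real_of_int s) (f i)
    \<le> real_of_int s powr (- (real (degree (f i)) / 2)) *
       (2 powr (real d * (real d - 1) / 4) * real_of_int s powr (real d ^ 2 / 2)
        * (real_of_int a_tilde / real_of_int a)
        * vec_inv_skew_norm (real_of_int s) (map_vec real_of_int c))
       powr (1 / (real d - real i + 1))"
    unfolding norm_f K_def by (intro mult_left_mono) (simp_all add: mult.assoc)
qed

end
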